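(* Let $G$ be a group. Let $\{C_i\}_{i\in I}$ be a set of different conjugacy classes of $G$, and let $Y=\bigcup_{i\in I}C_i$. Fix an element $g_i\in C_i$ for each $i\in I$, and consider subgroups $K_{i,j}\leq C_G(g_i)$, $j\in J_i$, where $J_i$ is a non-empty set. Suppose that $\langle Y\rangle=G$ and that $\operatorname{core}\left(\bigcap_{i,j}K_{i,j}\right)=\{1\}$. Then the set $X=\bigsqcup_{i,j}G/K_{i,j}$ (disjoint union of the sets of left cosets, over $i\in I$, $j\in J_i$), with operation $$(xK_{i,j})\circ(yK_{a,b})=xg_i^{-1}x^{-1}yK_{a,b},$$ is a rack. Moreover, any rack is isomorphic to one of this form.
   Context: A rack is a set $X$ with a binary operation $\circ$ such that $a\circ(b\circ c)=(a\circ b)\circ(a\circ c)$ for all $a,b,c\in X$ and such that for each $a\in X$ the map $b\mapsto a\circ b$ is bijective. $C_G(g)$ denotes the centralizer of $g$ in $G$, and for a subgroup $H\leq G$, $\operatorname{core}(H)=\bigcap_{g\in G}gHg^{-1}$. *)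

theory Defs
  imports "HOL-Algebra.Left_Coset" "HOL-Algebra.Generated_Groups"
begin

section \<open>Racks\<close>

text \<open>Closure of \<open>X\<close> under the operation is part of \<open>bij_left\<close>. The empty rack is allowed.\<close>

locale rack =
  fixes X :: "'r set" and rop :: "'r \<Rightarrow> 'r \<Rightarrow> 'r" (infixr \<open>\<triangleright>\<close> 70)
  assumes self_distrib:
    "\<lbrakk>a \<in> X; b \<in> X; c \<in> X\<rbrakk> \<Longrightarrow> a \<triangleright> (b \<triangleright> c) = (a \<triangleright> b) \<triangleright> (a \<triangleright> c)"
  and bij_left: "a \<in> X \<Longrightarrow> bij_betw (\<lambda>b. a \<triangleright> b) X X"

definition rack_iso ::
    "'r set \<Rightarrow> ('r \<Rightarrow> 'r \<Rightarrow> 'r) \<Rightarrow> 's set \<Rightarrow> ('s \<Rightarrow> 's \<Rightarrow> 's) \<Rightarrow> ('r \<Rightarrow> 's) \<Rightarrow> bool"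
  where "rack_iso X rop X' rop' f \<longleftrightarrow>
    bij_betw f X X' \<and> (\<forall>a\<in>X. \<forall>b\<in>X. f (rop a b) = rop' (f a) (f b))"


section \<open>Conjugacy classes, centralizers and cores\<close>

definition conj_class :: "('a, 'm) monoid_scheme \<Rightarrow> 'a \<Rightarrow> 'a set"
  where "conj_class G a = {x \<otimes>\<^bsub>G\<^esub> a \<otimes>\<^bsub>G\<^esub> inv\<^bsub>G\<^esub> x | x. x \<in> carrier G}"

definition conj_classes :: "('a, 'm) monoid_scheme \<Rightarrow> 'a set set"
  where "conj_classes G = conj_class G ` carrier G"

definition centralizer :: "('a, 'm) monoid_scheme \<Rightarrow> 'a \<Rightarrow> 'a set"
  where "centralizer G a = {x \<in> carrier G. x \<otimes>\<^bsub>G\<^esub> a = a \<otimes>\<^bsub>G\<^esub> x}"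

definition core :: "('a, 'm) monoid_scheme \<Rightarrow> 'a set \<Rightarrow> 'a set"
  where "core G H = (\<Inter>x\<in>carrier G. x <#\<^bsub>G\<^esub> H #>\<^bsub>G\<^esub> inv\<^bsub>G\<^esub> x)"


section \<open>Coset racks\<close>

text \<open>In \<open>core_trivial\<close>, intersecting with \<open>carrier G\<close> only matters if \<open>I\<close> is empty: the
  intersection of an empty family of subgroups of \<open>G\<close> is \<open>G\<close>.\<close>

locale coset_rack_data = group G for G :: "('a, 'm) monoid_scheme" (structure) +
  fixes I :: "'i set"
    and C :: "'i \<Rightarrow> 'a set"
    and g :: "'i \<Rightarrow> 'a"
    and J :: "'i \<Rightarrow> 'j set"
    and K :: "'i \<Rightarrow> 'j \<Rightarrow> 'a set"
  assumes classes: "i \<in> I \<Longrightarrow> C i \<in> conj_classes G"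
    and classes_distinct: "inj_on C I"
    and representative: "i \<in> I \<Longrightarrow> g i \<in> C i"
    and J_nonempty: "i \<in> I \<Longrightarrow> J i \<noteq> {}"
    and K_subgroup: "\<lbrakk>i \<in> I; j \<in> J i\<rbrakk> \<Longrightarrow> subgroup (K i j) G"
    and K_centralizes: "\<lbrakk>i \<in> I; j \<in> J i\<rbrakk> \<Longrightarrow> K i j \<subseteq> centralizer G (g i)"
    and generates: "generate G (\<Union>i\<in>I. C i) = carrier G"
    and core_trivial: "core G (carrier G \<inter> (\<Inter>i\<in>I. \<Inter>j\<in>J i. K i j)) = {\<one>}"

text \<open>The coset \<open>x K\<^sub>i\<^sub>,\<^sub>j\<close>, as an element of the disjoint union, is the triple
  \<open>(i, j, x <# K i j)\<close>.\<close>

definition coset_rack ::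
    "('a, 'm) monoid_scheme \<Rightarrow> 'i set \<Rightarrow> ('i \<Rightarrow> 'j set) \<Rightarrow> ('i \<Rightarrow> 'j \<Rightarrow> 'a set)
      \<Rightarrow> ('i \<times> 'j \<times> 'a set) set"
  where "coset_rack G I J K = (SIGMA i:I. SIGMA j:J i. lcosets\<^bsub>G\<^esub> (K i j))"

text \<open>The union ranges over all representatives of the two cosets. If the result does not depend
  on the representatives, it is the coset \<open>x g\<^sub>i\<inverse> x\<inverse> y K\<^sub>a\<^sub>,\<^sub>b\<close> for any choice of them.\<close>

definition coset_rack_op ::
    "('a, 'm) monoid_scheme \<Rightarrow> ('i \<Rightarrow> 'a) \<Rightarrow> ('i \<Rightarrow> 'j \<Rightarrow> 'a set)
      \<Rightarrow> 'i \<times> 'j \<times> 'a set \<Rightarrow> 'i \<times> 'j \<times> 'a set \<Rightarrow> 'i \<times> 'j \<times> 'a set"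
  where "coset_rack_op G g K = (\<lambda>(i, j, A) (a, b, B).
    (a, b, \<Union>x\<in>A. \<Union>y\<in>B.
       (x \<otimes>\<^bsub>G\<^esub> inv\<^bsub>G\<^esub> (g i) \<otimes>\<^bsub>G\<^esub> inv\<^bsub>G\<^esub> x \<otimes>\<^bsub>G\<^esub> y) <#\<^bsub>G\<^esub> K a b))"

end

theory Submission
  imports Defs "HOL-Algebra.Group_Action"
begin

text \<open>In a coset rack, the point \<open>x K\<^sub>i\<^sub>,\<^sub>j\<close> acts on all cosets as left multiplication by the
  conjugate \<open>x g\<^sub>i\<inverse> x\<inverse>\<close>. This conjugate depends only on the coset because \<open>K\<^sub>i\<^sub>,\<^sub>j\<close>
  centralizes \<open>g\<^sub>i\<close>. Left multiplication by \<open>u\<close> sends \<open>y K\<^sub>a\<^sub>,\<^sub>b\<close> to \<open>u y K\<^sub>a\<^sub>,\<^sub>b\<close>, and so it conjugates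
  the group element attached to that point by \<open>u\<close>. Self-distributivity is just this remark
  (\<open>conj_mult_translate\<close>).

  Conversely, let \<open>X\<close> be a rack with left translations \<open>L a\<close>. Self-distributivity says that each
  \<open>L a\<close> is an automorphism, and an automorphism \<open>h\<close> satisfies \<open>L (h a) = h (L a) h\<inverse>\<close>. Let \<open>G\<close> be the
  permutation group of \<open>X\<close> generated by the elements \<open>\<delta> a = (L a)\<inverse>\<close>. It acts faithfully on \<open>X\<close>,
  and \<open>\<delta>\<close> is equivariant from this action to conjugation. Hence all points of a \<open>G\<close>-orbit have
  their \<open>\<delta>\<close> in one conjugacy class. Take for \<open>I\<close> one point of \<open>X\<close> for each conjugacy class that
  meets the image of \<open>\<delta>\<close>, with \<open>g\<^sub>i = \<delta> i\<close>. Several orbits may lie over the same class; they are the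
  index set \<open>J\<^sub>i\<close>. By equivariance each of these orbits contains a point \<open>j\<close> with \<open>\<delta> j = \<delta> i\<close>
  exactly, not merely up to conjugacy. For such a \<open>j\<close> the stabilizer \<open>K\<^sub>i\<^sub>,\<^sub>j\<close> of \<open>j\<close> centralizes
  \<open>g\<^sub>i\<close>, again by equivariance, and the orbit of \<open>j\<close> is \<open>G/K\<^sub>i\<^sub>,\<^sub>j\<close>. The core of the intersection of
  all these stabilizers fixes every point of \<open>X\<close>, so it is trivial by faithfulness.

  This argument uses only the group, its faithful action and \<open>\<delta>\<close>. It is therefore carried out in
  the locale \<open>equivariant_generators\<close>, of which the inner group of a rack is an instance.\<close>

section \<open>Groups and conjugacy classes\<close>

lemma (in group) inv_mult_cancel:
  assumes "x \<in> carrier G" "y \<in> carrier G"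
  shows "inv x \<otimes> (x \<otimes> y) = y" "x \<otimes> (inv x \<otimes> y) = y"
  using assms by (simp_all add: m_assoc[symmetric])

text \<open>With \<open>u\<close> the element by which a point acts, this is the self-distributive law on representatives.\<close>

lemma (in group) conj_mult_translate:
  assumes "u \<in> carrier G" "y \<in> carrier G" "k \<in> carrier G" "z \<in> carrier G"
  shows "(u \<otimes> y) \<otimes> k \<otimes> inv (u \<otimes> y) \<otimes> (u \<otimes> z) = u \<otimes> (y \<otimes> k \<otimes> inv y \<otimes> z)"
  using assms by (simp add: m_assoc inv_mult_group inv_mult_cancel)

lemma (in group) conj_class_conj:
  assumes h: "h \<in> carrier G" and a: "a \<in> carrier G"
  shows "conj_class G (h \<otimes> a \<otimes> inv h) = conj_class G a"
proof -
  have sub: "conj_class G (k \<otimes> b \<otimes> inv k) \<subseteq> conj_class G b"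
    if "k \<in> carrier G" "b \<in> carrier G" for k b
  proof
    fix u assume "u \<in> conj_class G (k \<otimes> b \<otimes> inv k)"
    then obtain x where x: "x \<in> carrier G" "u = x \<otimes> (k \<otimes> b \<otimes> inv k) \<otimes> inv x"
      by (auto simp: conj_class_def)
    then have "u = (x \<otimes> k) \<otimes> b \<otimes> inv (x \<otimes> k)"
      using that by (simp add: m_assoc inv_mult_group)
    then show "u \<in> conj_class G b"
      unfolding conj_class_def using x that m_closed by blast
  qed
  have "inv h \<otimes> (h \<otimes> a \<otimes> inv h) \<otimes> inv (inv h) = a"
    using h a by (simp add: m_assoc inv_mult_cancel)
  then show ?thesis
    using sub[of h a] sub[of "inv h" "h \<otimes> a \<otimes> inv h"] h a by simp
qed

lemma (in group) mem_conj_class_self: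
  assumes "a \<in> carrier G"
  shows "a \<in> conj_class G a"
  unfolding conj_class_def using assms by (auto intro!: exI[of _ \<one>])


section \<open>Coset racks are racks\<close>

context coset_rack_data
begin

lemma g_closed: "i \<in> I \<Longrightarrow> g i \<in> carrier G"
  using classes[of i] representative[of i] by (auto simp: conj_classes_def conj_class_def)

lemma K_subset: "\<lbrakk>i \<in> I; j \<in> J i\<rbrakk> \<Longrightarrow> K i j \<subseteq> carrier G"
  using K_subgroup subgroup.subset by blast

text \<open>An element of \<open>K i j\<close> commutes with \<open>g i\<close>, so changing the representative of the coset by it
  does not change the conjugate.\<close>

lemma conj_inv_g_eq:
  assumes i: "i \<in> I" "j \<in> J i" and x: "x \<in> carrier G" "x' \<in> x <# K i j"
  shows "x' \<otimes> inv (g i) \<otimes> inv x' = x \<otimes> inv (g i) \<otimes> inv x"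
proof -
  obtain k where k: "k \<in> K i j" "x' = x \<otimes> k"
    using x by (auto simp: l_coset_def)
  have kG: "k \<in> carrier G" and gG: "g i \<in> carrier G"
    using k i K_subset g_closed by auto
  have "k \<otimes> g i = g i \<otimes> k"
    using K_centralizes[OF i] k by (auto simp: centralizer_def)
  then have "inv (g i) \<otimes> (k \<otimes> g i) \<otimes> inv (g i) = inv (g i) \<otimes> (g i \<otimes> k) \<otimes> inv (g i)"
    by simp
  then have "inv (g i) \<otimes> k = k \<otimes> inv (g i)"
    using kG gG by (simp add: m_assoc inv_mult_cancel)
  then have "k \<otimes> inv (g i) \<otimes> inv k = inv (g i) \<otimes> k \<otimes> inv k"
    by simp
  then have "k \<otimes> inv (g i) \<otimes> inv k = inv (g i)"
    using kG gG by (simp add: m_assoc)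
  moreover have "x' \<otimes> inv (g i) \<otimes> inv x' = x \<otimes> (k \<otimes> inv (g i) \<otimes> inv k) \<otimes> inv x"
    using k(2) kG gG x(1) by (simp add: m_assoc inv_mult_group)
  ultimately show ?thesis by simp
qed

lemma coset_rack_op_cosets:
  assumes i: "i \<in> I" "j \<in> J i" and a: "a \<in> I" "b \<in> J a"
    and x: "x \<in> carrier G" and y: "y \<in> carrier G"
  shows "coset_rack_op G g K (i, j, x <# K i j) (a, b, y <# K a b)
    = (a, b, (x \<otimes> inv (g i) \<otimes> inv x \<otimes> y) <# K a b)"
proof -
  let ?u = "x \<otimes> inv (g i) \<otimes> inv x"
  have u: "?u \<in> carrier G" using x g_closed i by simp
  have "(x' \<otimes> inv (g i) \<otimes> inv x' \<otimes> y') <# K a b = (?u \<otimes> y) <# K a b"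
    if x': "x' \<in> x <# K i j" and y': "y' \<in> y <# K a b" for x' y'
  proof -
    have y'G: "y' \<in> carrier G"
      using l_coset_carrier[OF y' y K_subgroup[OF a]] .
    have "(?u \<otimes> y') <# K a b = ?u <# (y' <# K a b)"
      using lcos_m_assoc[OF K_subset[OF a] u y'G] by simp
    also have "\<dots> = ?u <# (y <# K a b)"
      using l_repr_independence[OF y' y K_subgroup[OF a]] by simp
    also have "\<dots> = (?u \<otimes> y) <# K a b"
      using lcos_m_assoc[OF K_subset[OF a] u y] .
    finally show ?thesis
      using conj_inv_g_eq[OF i x x'] by simp
  qed
  moreover have "x \<in> x <# K i j" "y \<in> y <# K a b"
    using lcos_self K_subgroup i a x y by auto
  ultimately have "(\<Union>x'\<in>x <# K i j. \<Union>y'\<in>y <# K a b.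
      (x' \<otimes> inv (g i) \<otimes> inv x' \<otimes> y') <# K a b) = (?u \<otimes> y) <# K a b"
    by blast
  then show ?thesis
    by (simp add: coset_rack_op_def)
qed

lemma coset_rackE:
  assumes "p \<in> coset_rack G I J K"
  obtains i j x where "i \<in> I" "j \<in> J i" "x \<in> carrier G" "p = (i, j, x <# K i j)"
  using assms by (auto simp: coset_rack_def LCOSETS_def)

lemma coset_rackI:
  "\<lbrakk>i \<in> I; j \<in> J i; x \<in> carrier G\<rbrakk> \<Longrightarrow> (i, j, x <# K i j) \<in> coset_rack G I J K"
  by (auto simp: coset_rack_def LCOSETS_def)

theorem rack_coset_rack: "rack (coset_rack G I J K) (coset_rack_op G g K)"
proof
  let ?R = "coset_rack G I J K" and ?op = "coset_rack_op G g K"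
  show "?op p (?op q r) = ?op (?op p q) (?op p r)"
    if "p \<in> ?R" "q \<in> ?R" "r \<in> ?R" for p q r
  proof -
    obtain i j x where p: "i \<in> I" "j \<in> J i" "x \<in> carrier G" "p = (i, j, x <# K i j)"
      using \<open>p \<in> ?R\<close> by (rule coset_rackE)
    obtain a b y where q: "a \<in> I" "b \<in> J a" "y \<in> carrier G" "q = (a, b, y <# K a b)"
      using \<open>q \<in> ?R\<close> by (rule coset_rackE)
    obtain c d z where r: "c \<in> I" "d \<in> J c" "z \<in> carrier G" "r = (c, d, z <# K c d)"
      using \<open>r \<in> ?R\<close> by (rule coset_rackE)
    have [simp]: "g i \<in> carrier G" "g a \<in> carrier G"
      using p q g_closed by auto
    show ?thesis
      using p q r by (simp add: coset_rack_op_cosets conj_mult_translate)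
  qed
  show "bij_betw (?op p) ?R ?R" if p: "p \<in> ?R" for p
  proof -
    obtain i j x where p: "i \<in> I" "j \<in> J i" "x \<in> carrier G" "p = (i, j, x <# K i j)"
      using \<open>p \<in> ?R\<close> by (rule coset_rackE)
    define u where "u = x \<otimes> inv (g i) \<otimes> inv x"
    have u: "u \<in> carrier G" using p g_closed by (simp add: u_def)
    have op: "?op p (a, b, y <# K a b) = (a, b, (u \<otimes> y) <# K a b)"
      if "a \<in> I" "b \<in> J a" "y \<in> carrier G" for a b y
      using p that by (simp add: coset_rack_op_cosets u_def)
    \<comment> \<open>The inverse of the left translation: left multiplication by the inverse element.\<close>
    define w where "w = (\<lambda>(a :: 'i, b :: 'j, B). (a, b, inv u <# B))"
    have w: "w (a, b, y <# K a b) = (a, b, (inv u \<otimes> y) <# K a b)"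
      if "a \<in> I" "b \<in> J a" "y \<in> carrier G" for a b y
      using that u K_subset by (simp add: w_def lcos_m_assoc)
    have cancel: "inv u \<otimes> (u \<otimes> y) = y" "u \<otimes> (inv u \<otimes> y) = y" if "y \<in> carrier G" for y
      using that u by (simp_all add: m_assoc[symmetric])
    show ?thesis
    proof (rule bij_betw_byWitness[where f' = w])
      show "\<forall>q\<in>?R. w (?op p q) = q"
        using u by (auto elim!: coset_rackE simp: op w cancel)
      show "\<forall>q\<in>?R. ?op p (w q) = q"
        using u by (auto elim!: coset_rackE simp: op w cancel)
      show "?op p ` ?R \<subseteq> ?R"
        using u by (auto elim!: coset_rackE simp: op intro!: coset_rackI)
      show "w ` ?R \<subseteq> ?R"
        using u by (auto elim!: coset_rackE simp: w intro!: coset_rackI)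
    qed
  qed
qed

end


section \<open>Racks from an equivariant map into an acting group\<close>

lemma (in group_action) orbit_eq_iff:
  assumes "a \<in> E" "b \<in> E"
  shows "orbit G \<phi> a = orbit G \<phi> b \<longleftrightarrow> (\<exists>x\<in>carrier G. \<phi> x a = b)"
proof
  assume "orbit G \<phi> a = orbit G \<phi> b"
  then have "b \<in> orbit G \<phi> a" using orbit_refl assms by simp
  then show "\<exists>x\<in>carrier G. \<phi> x a = b" by (auto simp: orbit_def)
next
  assume "\<exists>x\<in>carrier G. \<phi> x a = b"
  then have b: "b \<in> orbit G \<phi> a" by (auto simp: orbit_def)
  have "orbit G \<phi> a \<subseteq> E" "orbit G \<phi> b \<subseteq> E"
    using assms element_image by (auto simp: orbit_def)
  then show "orbit G \<phi> a = orbit G \<phi> b"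
    using assms b orbit_sym orbit_trans by (meson subset_antisym subsetD subsetI)
qed

text \<open>The orbit-stabilizer correspondence: the elements that carry \<open>s\<close> to a given point of its orbit
  form the left coset attached to that point.\<close>

lemma (in group_action) transporter_eq_l_coset:
  assumes s: "s \<in> E" and x: "x \<in> carrier G"
  shows "{h \<in> carrier G. \<phi> h s = \<phi> x s} = x <# stabilizer G \<phi> s"
proof -
  interpret group G
    using group_hom group_hom.axioms(1) by auto
  show ?thesis
  proof
    show "x <# stabilizer G \<phi> s \<subseteq> {h \<in> carrier G. \<phi> h s = \<phi> x s}"
      using s x by (auto simp: l_coset_def stabilizer_def composition_rule)
    show "{h \<in> carrier G. \<phi> h s = \<phi> x s} \<subseteq> x <# stabilizer G \<phi> s"
    proof
      fix h assume h: "h \<in> {h \<in> carrier G. \<phi> h s = \<phi> x s}"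
      have "inv x \<otimes> h \<in> stabilizer G \<phi> s"
        using h s x orbit_sym_aux[OF x s refl] by (auto simp: stabilizer_def composition_rule)
      moreover have "h = x \<otimes> (inv x \<otimes> h)"
        using h x by (simp add: m_assoc[symmetric])
      ultimately show "h \<in> x <# stabilizer G \<phi> s"
        by (auto simp: l_coset_def)
    qed
  qed
qed

text \<open>The operation \<open>a \<triangleright> b = \<phi> (inv (\<delta> a)) b\<close> makes \<open>X\<close> a rack. The inverse matches the
  \<open>inv (g i)\<close> in the operation of a coset rack, so that \<open>\<delta>\<close> itself takes the values \<open>g i\<close>.\<close>

locale equivariant_generators = faithful_action G X \<phi>
  for G :: "('a, 'm) monoid_scheme" (structure) and X :: "'r set" and \<phi> +
  fixes \<delta> :: "'r \<Rightarrow> 'a"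
  assumes \<delta>_closed: "a \<in> X \<Longrightarrow> \<delta> a \<in> carrier G"
    and \<delta>_equivariant: "\<lbrakk>x \<in> carrier G; a \<in> X\<rbrakk> \<Longrightarrow> \<delta> (\<phi> x a) = x \<otimes> \<delta> a \<otimes> inv x"
    and \<delta>_generates: "generate G (\<delta> ` X) = carrier G"
begin

sublocale group G
  using group_hom group_hom.axioms(1) by auto

text \<open>The index \<open>i\<close> of a conjugacy class of the coset data is a point of \<open>X\<close>. Since \<open>class_rep\<close>
  depends on \<open>a\<close> only through the class of \<open>\<delta> a\<close>, its values represent each class once.\<close>

definition class_rep :: "'r \<Rightarrow> 'r" where
  "class_rep a = (SOME c. c \<in> X \<and> conj_class G (\<delta> c) = conj_class G (\<delta> a))"

text \<open>The representative of an orbit must have \<open>\<delta>\<close> equal to the chosen element of the conjugacy class;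
  otherwise its stabilizer would centralize only a conjugate of that element.\<close>

definition orbit_rep :: "'r \<Rightarrow> 'r" where
  "orbit_rep a = (SOME c. c \<in> X \<and> orbit G \<phi> c = orbit G \<phi> a \<and> \<delta> c = \<delta> (class_rep a))"

lemma act_closed: "\<lbrakk>x \<in> carrier G; a \<in> X\<rbrakk> \<Longrightarrow> \<phi> x a \<in> X"
  using element_image by blast

lemma class_rep:
  assumes "a \<in> X"
  shows "class_rep a \<in> X" "conj_class G (\<delta> (class_rep a)) = conj_class G (\<delta> a)"
  using assms unfolding class_rep_def by (metis (mono_tags, lifting) someI_ex)+

lemma class_rep_cong:
  "conj_class G (\<delta> a) = conj_class G (\<delta> b) \<Longrightarrow> class_rep a = class_rep b"
  by (simp add: class_rep_def)

text \<open>A suitable point exists: if \<open>\<delta> (class_rep a)\<close> is the conjugate of \<open>\<delta> a\<close> by \<open>x\<close>, then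
  equivariance makes it the value of \<open>\<delta>\<close> at \<open>\<phi> x a\<close>.\<close>

lemma orbit_rep:
  assumes a: "a \<in> X"
  shows "orbit_rep a \<in> X" "orbit G \<phi> (orbit_rep a) = orbit G \<phi> a"
    "\<delta> (orbit_rep a) = \<delta> (class_rep a)"
proof -
  have "\<delta> (class_rep a) \<in> conj_class G (\<delta> a)"
    using mem_conj_class_self[OF \<delta>_closed] class_rep[OF a] by metis
  then obtain x where x: "x \<in> carrier G" "\<delta> (class_rep a) = x \<otimes> \<delta> a \<otimes> inv x"
    by (auto simp: conj_class_def)
  then have "\<phi> x a \<in> X \<and> orbit G \<phi> (\<phi> x a) = orbit G \<phi> a \<and> \<delta> (\<phi> x a) = \<delta> (class_rep a)"
    using a act_closed \<delta>_equivariant orbit_eq_iff[OF a] by metis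
  then have "\<exists>c. c \<in> X \<and> orbit G \<phi> c = orbit G \<phi> a \<and> \<delta> c = \<delta> (class_rep a)" ..
  from someI_ex[OF this, folded orbit_rep_def]
  show "orbit_rep a \<in> X" "orbit G \<phi> (orbit_rep a) = orbit G \<phi> a"
    "\<delta> (orbit_rep a) = \<delta> (class_rep a)" by blast+
qed

lemma class_rep_act:
  assumes "x \<in> carrier G" "a \<in> X"
  shows "class_rep (\<phi> x a) = class_rep a"
  using assms by (intro class_rep_cong) (simp add: \<delta>_equivariant conj_class_conj \<delta>_closed)

lemma orbit_rep_act:
  assumes "x \<in> carrier G" "a \<in> X"
  shows "orbit_rep (\<phi> x a) = orbit_rep a"
proof -
  have "orbit G \<phi> (\<phi> x a) = orbit G \<phi> a"
    using assms act_closed orbit_eq_iff by metis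
  then show ?thesis
    using assms by (simp add: orbit_rep_def class_rep_act)
qed

lemma orbit_rep_transport:
  assumes "a \<in> X"
  obtains x where "x \<in> carrier G" "\<phi> x (orbit_rep a) = a"
  using orbit_rep[OF assms] orbit_eq_iff assms by blast

abbreviation rep_set :: "'r \<Rightarrow> 'r set" where
  "rep_set i \<equiv> orbit_rep ` {a \<in> X. class_rep a = i}"

text \<open>The isomorphism to the coset rack: a point is recorded by the class, the orbit, and its
  position in the orbit as the coset of the elements that carry the orbit representative to it.\<close>

abbreviation decomposition :: "'r \<Rightarrow> 'r \<times> 'r \<times> 'a set" where
  "decomposition a \<equiv>
    (class_rep a, orbit_rep a, {h \<in> carrier G. \<phi> h (orbit_rep a) = a})"

lemma decomposition_act_orbit_rep:
  assumes a: "a \<in> X" and x: "x \<in> carrier G" "\<phi> x (orbit_rep a) = a"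
  shows "decomposition a = (class_rep a, orbit_rep a, x <# stabilizer G \<phi> (orbit_rep a))"
  using transporter_eq_l_coset[OF orbit_rep(1)[OF a] x(1)] x(2) by simp

lemma generate_conj_classes_eq_carrier:
  "generate G (\<Union>i\<in>class_rep ` X. conj_class G (\<delta> i)) = carrier G"
proof
  have cl: "(\<Union>i\<in>class_rep ` X. conj_class G (\<delta> i)) \<subseteq> carrier G"
    using class_rep(1) \<delta>_closed by (auto simp: conj_class_def)
  then show "generate G (\<Union>i\<in>class_rep ` X. conj_class G (\<delta> i)) \<subseteq> carrier G"
    by (rule generate_incl)
  have "\<delta> ` X \<subseteq> (\<Union>i\<in>class_rep ` X. conj_class G (\<delta> i))"
    using mem_conj_class_self[OF \<delta>_closed] class_rep(2) by blast
  then show "carrier G \<subseteq> generate G (\<Union>i\<in>class_rep ` X. conj_class G (\<delta> i))"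
    using mono_generate \<delta>_generates by metis
qed

text \<open>If \<open>x\<close> carries \<open>orbit_rep a\<close> to \<open>a\<close>, then an element of the core is the conjugate by \<open>x\<close> of an
  element fixing \<open>orbit_rep a\<close>, so it fixes \<open>a\<close>. An element fixing all points is trivial because
  the action is faithful.\<close>

lemma core_stabilizers_trivial:
  "core G (carrier G \<inter> (\<Inter>i\<in>class_rep ` X. \<Inter>j\<in>rep_set i. stabilizer G \<phi> j)) = {\<one>}"
  (is "core G ?H = _")
proof
  have one_fix: "\<phi> \<one> a = a" if "a \<in> X" for a
    using id_eq_one that by (metis restrict_apply')
  have "\<one> \<in> x <# ?H #> inv x" if x: "x \<in> carrier G" for x
  proof -
    have "\<one> \<in> ?H" using one_fix orbit_rep(1) by (auto simp: stabilizer_def)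
    then have "x \<otimes> \<one> \<otimes> inv x \<in> x <# ?H #> inv x"
      by (force simp: l_coset_def r_coset_def)
    then show ?thesis using x by simp
  qed
  then show "{\<one>} \<subseteq> core G ?H" by (simp add: core_def)
  show "core G ?H \<subseteq> {\<one>}"
  proof
    fix h assume h: "h \<in> core G ?H"
    have conj: "\<exists>k\<in>?H. h = x \<otimes> k \<otimes> inv x" if "x \<in> carrier G" for x
    proof -
      have "h \<in> x <# ?H #> inv x"
        using h that unfolding core_def by (rule INT_D)
      then show ?thesis
        unfolding l_coset_def r_coset_def by blast
    qed
    have hG: "h \<in> carrier G"
      using conj[OF one_closed] by auto
    have "\<phi> h a = a" if a: "a \<in> X" for a
    proof -
      obtain x where x: "x \<in> carrier G" "\<phi> x (orbit_rep a) = a"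
        using a by (rule orbit_rep_transport)
      obtain k where k: "k \<in> ?H" "h = x \<otimes> k \<otimes> inv x"
        using conj x(1) by blast
      have "k \<in> carrier G" "\<phi> k (orbit_rep a) = orbit_rep a"
        using k(1) a by (auto simp: stabilizer_def)
      moreover have "\<phi> (inv x) a = orbit_rep a"
        using orbit_sym_aux x orbit_rep(1)[OF a] by blast
      ultimately show ?thesis
        using k(2) x a act_closed orbit_rep(1)[OF a] by (simp add: composition_rule)
    qed
    \<comment> \<open>Elements of \<open>Bij X\<close> are extensional, so values on \<open>X\<close> determine them.\<close>
    then have "\<phi> h = \<phi> \<one>"
      using bij_prop0 hG one_fix
      by (intro extensionalityI[of _ X]) (auto simp: Bij_def)
    then show "h \<in> {\<one>}"
      using faithful hG by (simp add: inj_on_eq_iff)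
  qed
qed

lemma coset_rack_data_representatives:
  "coset_rack_data G (class_rep ` X) (\<lambda>i. conj_class G (\<delta> i)) \<delta> rep_set
    (\<lambda>i. stabilizer G \<phi>)"
proof (intro coset_rack_data.intro coset_rack_data_axioms.intro)
  show "group G" ..
  show "conj_class G (\<delta> i) \<in> conj_classes G" if "i \<in> class_rep ` X" for i
    using that class_rep(1) \<delta>_closed by (auto simp: conj_classes_def)
  show "inj_on (\<lambda>i. conj_class G (\<delta> i)) (class_rep ` X)"
  proof (rule inj_onI)
    fix i j assume "i \<in> class_rep ` X" "j \<in> class_rep ` X"
      and eq: "conj_class G (\<delta> i) = conj_class G (\<delta> j)"
    then obtain a b where ab: "a \<in> X" "i = class_rep a" "b \<in> X" "j = class_rep b"
      by blast
    then have "conj_class G (\<delta> a) = conj_class G (\<delta> b)"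
      using eq by (simp add: class_rep(2))
    then show "i = j"
      unfolding ab by (rule class_rep_cong)
  qed
  show "\<delta> i \<in> conj_class G (\<delta> i)" if "i \<in> class_rep ` X" for i
    using that class_rep(1) \<delta>_closed mem_conj_class_self by auto
  show "rep_set i \<noteq> {}" if "i \<in> class_rep ` X" for i
    using that by auto
  show "subgroup (stabilizer G \<phi> j) G" if "j \<in> rep_set i" for i j
    using that orbit_rep(1) stabilizer_subgroup by auto
  show "stabilizer G \<phi> j \<subseteq> centralizer G (\<delta> i)" if j: "j \<in> rep_set i" for i j
  proof
    fix h assume h: "h \<in> stabilizer G \<phi> j"
    have j: "j \<in> X" "\<delta> j = \<delta> i"
      using j orbit_rep by auto
    have hG: "h \<in> carrier G" "\<phi> h j = j"
      using h by (auto simp: stabilizer_def)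
    \<comment> \<open>Equivariance turns a fixed point of \<open>h\<close> into an element commuting with \<open>h\<close>.\<close>
    then have "\<delta> i = h \<otimes> \<delta> i \<otimes> inv h"
      using \<delta>_equivariant j by metis
    then have "h \<otimes> \<delta> i = \<delta> i \<otimes> h"
      using hG j \<delta>_closed[OF j(1)] by (metis inv_solve_right m_closed)
    then show "h \<in> centralizer G (\<delta> i)"
      using hG by (simp add: centralizer_def)
  qed
  show "generate G (\<Union>i\<in>class_rep ` X. conj_class G (\<delta> i)) = carrier G"
    by (rule generate_conj_classes_eq_carrier)
  show "core G (carrier G \<inter> (\<Inter>i\<in>class_rep ` X. \<Inter>j\<in>rep_set i. stabilizer G \<phi> j)) = {\<one>}"
    by (rule core_stabilizers_trivial)
qed

lemma bij_betw_decomposition: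
  "bij_betw decomposition X (coset_rack G (class_rep ` X) rep_set (\<lambda>i. stabilizer G \<phi>))"
  (is "bij_betw _ X ?R")
proof (rule bij_betw_imageI)
  show "inj_on decomposition X"
  proof (rule inj_onI)
    fix a b assume ab: "a \<in> X" "b \<in> X" "decomposition a = decomposition b"
    obtain x where x: "x \<in> carrier G" "\<phi> x (orbit_rep a) = a"
      using ab(1) by (rule orbit_rep_transport)
    then have "x \<in> {h \<in> carrier G. \<phi> h (orbit_rep a) = a}"
      by blast
    then have "\<phi> x (orbit_rep b) = b"
      using ab(3) by blast
    moreover have "orbit_rep a = orbit_rep b"
      using ab(3) by blast
    ultimately show "a = b"
      using x(2) by metis
  qed
  show "decomposition ` X = ?R"
  proof
    show "decomposition ` X \<subseteq> ?R"
    proof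
      fix p assume "p \<in> decomposition ` X"
      then obtain a where a: "a \<in> X" "p = decomposition a" by blast
      obtain x where x: "x \<in> carrier G" "\<phi> x (orbit_rep a) = a"
        using a(1) by (rule orbit_rep_transport)
      have "(class_rep a, orbit_rep a, x <# stabilizer G \<phi> (orbit_rep a)) \<in> ?R"
        using a(1) x(1) by (auto simp: coset_rack_def LCOSETS_def)
      then show "p \<in> ?R"
        using a decomposition_act_orbit_rep[OF a(1) x] by (simp only:)
    qed
    show "?R \<subseteq> decomposition ` X"
    proof
      fix p assume "p \<in> ?R"
      then obtain a y where a: "a \<in> X" "y \<in> carrier G"
        "p = (class_rep a, orbit_rep a, y <# stabilizer G \<phi> (orbit_rep a))"
        by (auto simp: coset_rack_def LCOSETS_def)
      obtain x where x: "x \<in> carrier G" "\<phi> x (orbit_rep a) = a"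
        using a(1) by (rule orbit_rep_transport)
      \<comment> \<open>The point of the orbit to which \<open>y\<close> carries \<open>orbit_rep a\<close>.\<close>
      define c where "c = \<phi> (y \<otimes> inv x) a"
      have c: "c \<in> X" "class_rep c = class_rep a" "orbit_rep c = orbit_rep a"
        using a x by (simp_all add: c_def act_closed class_rep_act orbit_rep_act)
      have "\<phi> (inv x) a = orbit_rep a"
        using orbit_sym_aux x orbit_rep(1)[OF a(1)] by blast
      then have "\<phi> y (orbit_rep c) = c"
        using a x c(3) by (simp add: c_def composition_rule)
      then have "decomposition c = p"
        using decomposition_act_orbit_rep[OF c(1) a(2)] c a(3) by simp
      then show "p \<in> decomposition ` X" using c(1) by blast
    qed
  qed
qed

text \<open>If \<open>x\<close> carries \<open>orbit_rep a\<close> to \<open>a\<close>, then \<open>\<delta> a\<close> is the conjugate of \<open>\<delta> (class_rep a)\<close> by \<open>x\<close>.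
  Acting by \<open>inv (\<delta> a)\<close> on \<open>b\<close> therefore multiplies the coset of \<open>b\<close> by exactly the element that the
  coset rack prescribes.\<close>

theorem rack_iso_decomposition:
  "rack_iso X (\<lambda>a. \<phi> (inv (\<delta> a)))
    (coset_rack G (class_rep ` X) rep_set (\<lambda>i. stabilizer G \<phi>))
    (coset_rack_op G \<delta> (\<lambda>i. stabilizer G \<phi>)) decomposition"
  unfolding rack_iso_def
proof (intro conjI ballI)
  interpret D: coset_rack_data G "class_rep ` X" "\<lambda>i. conj_class G (\<delta> i)" \<delta> rep_set
    "\<lambda>i. stabilizer G \<phi>"
    by (rule coset_rack_data_representatives)
  fix a b assume ab: "a \<in> X" "b \<in> X"
  obtain x where x: "x \<in> carrier G" "\<phi> x (orbit_rep a) = a"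
    using ab(1) by (rule orbit_rep_transport)
  obtain y where y: "y \<in> carrier G" "\<phi> y (orbit_rep b) = b"
    using ab(2) by (rule orbit_rep_transport)
  define c where "c = \<phi> (inv (\<delta> a)) b"
  have da: "\<delta> a \<in> carrier G" "\<delta> (class_rep a) \<in> carrier G"
    using ab \<delta>_closed class_rep by auto
  have c: "c \<in> X" "class_rep c = class_rep b" "orbit_rep c = orbit_rep b"
    using ab da by (simp_all add: c_def act_closed class_rep_act orbit_rep_act)
  have "\<delta> a = x \<otimes> \<delta> (class_rep a) \<otimes> inv x"
    using \<delta>_equivariant[OF x(1) orbit_rep(1)[OF ab(1)]] x(2) orbit_rep(3)[OF ab(1)] by simp
  then have conj: "inv (\<delta> a) = x \<otimes> inv (\<delta> (class_rep a)) \<otimes> inv x"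
    using x da by (simp add: inv_mult_group m_assoc)
  have cb: "\<phi> (inv (\<delta> a) \<otimes> y) (orbit_rep c) = c"
    using ab da y c(3) orbit_rep(1)[OF ab(2)] by (simp add: c_def composition_rule)
  have "decomposition c
      = (class_rep b, orbit_rep b, (inv (\<delta> a) \<otimes> y) <# stabilizer G \<phi> (orbit_rep b))"
    using decomposition_act_orbit_rep[OF c(1) _ cb] da y c by simp
  also have "\<dots> = coset_rack_op G \<delta> (\<lambda>i. stabilizer G \<phi>)
      (class_rep a, orbit_rep a, x <# stabilizer G \<phi> (orbit_rep a))
      (class_rep b, orbit_rep b, y <# stabilizer G \<phi> (orbit_rep b))"
    unfolding conj using ab x y by (intro D.coset_rack_op_cosets[symmetric]) auto
  also have "\<dots> = coset_rack_op G \<delta> (\<lambda>i. stabilizer G \<phi>) (decomposition a) (decomposition b)"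
    using decomposition_act_orbit_rep[OF ab(1) x] decomposition_act_orbit_rep[OF ab(2) y]
    by simp
  finally show "decomposition (\<phi> (inv (\<delta> a)) b)
      = coset_rack_op G \<delta> (\<lambda>i. stabilizer G \<phi>) (decomposition a) (decomposition b)"
    by (simp only: c_def)
qed (rule bij_betw_decomposition)

end


section \<open>The inner group of a rack\<close>

lemma BijGroup_mult_apply:
  "\<lbrakk>f \<in> carrier (BijGroup X); h \<in> carrier (BijGroup X); a \<in> X\<rbrakk>
    \<Longrightarrow> (f \<otimes>\<^bsub>BijGroup X\<^esub> h) a = f (h a)"
  by (simp add: BijGroup_def compose_eq)

lemma BijGroup_eqI:
  assumes "f \<in> carrier (BijGroup X)" "h \<in> carrier (BijGroup X)" "\<And>a. a \<in> X \<Longrightarrow> f a = h a"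
  shows "f = h"
  using assms by (intro extensionalityI[of _ X]) (auto simp: BijGroup_def Bij_def)

lemma BijGroup_apply_closed:
  "\<lbrakk>f \<in> carrier (BijGroup X); a \<in> X\<rbrakk> \<Longrightarrow> f a \<in> X"
  using Bij_imp_funcset by (fastforce simp: BijGroup_def)

lemma BijGroup_inv_apply:
  assumes "f \<in> carrier (BijGroup X)" "a \<in> X"
  shows "f ((inv\<^bsub>BijGroup X\<^esub> f) a) = a" "(inv\<^bsub>BijGroup X\<^esub> f) (f a) = a"
proof -
  interpret B: group "BijGroup X" by (rule group_BijGroup)
  have one: "\<one>\<^bsub>BijGroup X\<^esub> a = a" using assms(2) by (simp add: BijGroup_def)
  show "f ((inv\<^bsub>BijGroup X\<^esub> f) a) = a" "(inv\<^bsub>BijGroup X\<^esub> f) (f a) = a"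
    using assms one by (metis BijGroup_mult_apply B.inv_closed B.r_inv B.l_inv)+
qed

lemma faithful_action_subgroup_BijGroup:
  assumes "subgroup H (BijGroup X)"
  shows "faithful_action (BijGroup X\<lparr>carrier := H\<rparr>) X (\<lambda>h. h)"
proof -
  interpret B: group "BijGroup X" by (rule group_BijGroup)
  have "group_hom (BijGroup X\<lparr>carrier := H\<rparr>) (BijGroup X) (\<lambda>h. h)"
    using assms B.subgroup_imp_group group_BijGroup subgroup.subset
    by (fastforce simp: group_hom_def group_hom_axioms_def hom_def)
  then show ?thesis
    by (simp add: faithful_action_def group_action_def faithful_action_axioms_def inj_on_def)
qed

context rack
begin

definition left_translation :: "'r \<Rightarrow> 'r \<Rightarrow> 'r" where
  "left_translation a = restrict (\<lambda>b. a \<triangleright> b) X"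

definition rack_auts :: "('r \<Rightarrow> 'r) set" where
  "rack_auts = {h \<in> carrier (BijGroup X). \<forall>a\<in>X. \<forall>b\<in>X. h (a \<triangleright> b) = h a \<triangleright> h b}"

lemma op_closed: "\<lbrakk>a \<in> X; b \<in> X\<rbrakk> \<Longrightarrow> a \<triangleright> b \<in> X"
  using bij_left bij_betwE by blast

text \<open>This is where the axioms of a rack enter: bijectivity puts the left translation into the group
  of bijections, and self-distributivity says that it preserves the operation.\<close>

lemma left_translation_aut:
  assumes "a \<in> X"
  shows "left_translation a \<in> rack_auts"
proof -
  have "bij_betw (left_translation a) X X"
    using bij_left[OF assms] unfolding left_translation_def
    by (subst bij_betw_cong[where g = "\<lambda>b. a \<triangleright> b"]) auto
  then show ?thesis
    using assms op_closed self_distrib[OF assms]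
    by (simp add: rack_auts_def BijGroup_def Bij_def left_translation_def)
qed

lemma rack_auts_subgroup: "subgroup rack_auts (BijGroup X)"
proof -
  interpret B: group "BijGroup X" by (rule group_BijGroup)
  show ?thesis
  proof (rule B.subgroupI)
    show "rack_auts \<subseteq> carrier (BijGroup X)" by (auto simp: rack_auts_def)
    have "\<one>\<^bsub>BijGroup X\<^esub> \<in> rack_auts"
      using op_closed by (simp add: rack_auts_def) (simp add: BijGroup_def)
    then show "rack_auts \<noteq> {}" by blast
    fix h assume h: "h \<in> rack_auts"
    then have hB: "h \<in> carrier (BijGroup X)" by (simp add: rack_auts_def)
    let ?k = "inv\<^bsub>BijGroup X\<^esub> h"
    have kX: "?k a \<in> X" if "a \<in> X" for a
      using hB that by (simp add: BijGroup_apply_closed)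
    have "?k (a \<triangleright> b) = ?k a \<triangleright> ?k b" if ab: "a \<in> X" "b \<in> X" for a b
    proof -
      have "h (?k a \<triangleright> ?k b) = a \<triangleright> b"
        using h ab kX hB by (simp add: rack_auts_def BijGroup_inv_apply)
      then show ?thesis
        using BijGroup_inv_apply(2)[OF hB] op_closed kX ab by metis
    qed
    then show "?k \<in> rack_auts" using hB by (simp add: rack_auts_def)
    fix h' assume h': "h' \<in> rack_auts"
    then show "h \<otimes>\<^bsub>BijGroup X\<^esub> h' \<in> rack_auts"
      using h by (auto simp: rack_auts_def BijGroup_mult_apply BijGroup_apply_closed op_closed)
  qed
qed

text \<open>The law \<open>h (a \<triangleright> b) = h a \<triangleright> h b\<close>, evaluated at the preimage of a point under \<open>h\<close>, says that left
  translation is equivariant under automorphisms.\<close>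

lemma left_translation_aut_conj:
  assumes h: "h \<in> rack_auts" and a: "a \<in> X"
  shows "left_translation (h a)
    = h \<otimes>\<^bsub>BijGroup X\<^esub> left_translation a \<otimes>\<^bsub>BijGroup X\<^esub> inv\<^bsub>BijGroup X\<^esub> h"
proof -
  interpret B: group "BijGroup X" by (rule group_BijGroup)
  have hB: "h \<in> carrier (BijGroup X)" using h by (simp add: rack_auts_def)
  then have ha: "h a \<in> X" using a by (simp add: BijGroup_apply_closed)
  have tB: "left_translation c \<in> carrier (BijGroup X)" if "c \<in> X" for c
    using left_translation_aut[OF that] by (simp add: rack_auts_def)
  show ?thesis
  proof (rule BijGroup_eqI)
    fix b assume b: "b \<in> X"
    have k: "(inv\<^bsub>BijGroup X\<^esub> h) b \<in> X"
      using hB b by (simp add: BijGroup_apply_closed)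
    then show "left_translation (h a) b = (h \<otimes>\<^bsub>BijGroup X\<^esub> left_translation a
        \<otimes>\<^bsub>BijGroup X\<^esub> inv\<^bsub>BijGroup X\<^esub> h) b"
      using h hB a b tB[OF a]
      by (simp add: BijGroup_mult_apply left_translation_def rack_auts_def BijGroup_inv_apply)
  qed (use hB tB ha a in simp_all)
qed

text \<open>The inverses of the left translations generate the same group as the left translations; they
  are used here because they are the elements \<open>\<delta> a\<close>.\<close>

definition inner_group :: "('r \<Rightarrow> 'r) monoid" where
  "inner_group = BijGroup X\<lparr>carrier :=
    generate (BijGroup X) ((\<lambda>a. inv\<^bsub>BijGroup X\<^esub> left_translation a) ` X)\<rparr>"

lemma equivariant_generators_inner_group:
  "equivariant_generators inner_group X (\<lambda>h. h) (\<lambda>a. inv\<^bsub>BijGroup X\<^esub> left_translation a)"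
proof -
  interpret B: group "BijGroup X" by (rule group_BijGroup)
  let ?\<delta> = "\<lambda>a. inv\<^bsub>BijGroup X\<^esub> left_translation a"
  let ?H = "generate (BijGroup X) (?\<delta> ` X)"
  have auts: "?\<delta> ` X \<subseteq> rack_auts"
    using left_translation_aut rack_auts_subgroup by (auto intro: subgroup.m_inv_closed)
  then have "?\<delta> ` X \<subseteq> carrier (BijGroup X)" by (auto simp: rack_auts_def)
  then have H: "subgroup ?H (BijGroup X)" by (rule B.generate_is_subgroup)
  interpret faithful_action inner_group X "\<lambda>h. h"
    unfolding inner_group_def by (rule faithful_action_subgroup_BijGroup[OF H])
  show ?thesis
  proof unfold_locales
    show "?\<delta> a \<in> carrier inner_group" if "a \<in> X" for a
      using that by (simp add: inner_group_def generate.incl)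
    show "generate inner_group (?\<delta> ` X) = carrier inner_group"
      using B.generate_consistent[OF _ H, of "?\<delta> ` X"]
      by (simp add: inner_group_def generate.incl subsetI)
    show "?\<delta> (x a) = x \<otimes>\<^bsub>inner_group\<^esub> ?\<delta> a \<otimes>\<^bsub>inner_group\<^esub> inv\<^bsub>inner_group\<^esub> x"
      if x: "x \<in> carrier inner_group" and a: "a \<in> X" for x a
    proof -
      have xH: "x \<in> ?H" using x by (simp add: inner_group_def)
      then have xA: "x \<in> rack_auts"
        using B.generate_subgroup_incl[OF auts rack_auts_subgroup] by blast
      have "left_translation a \<in> carrier (BijGroup X)" "x \<in> carrier (BijGroup X)"
        using left_translation_aut[OF a] xA by (simp_all add: rack_auts_def)
      then have "?\<delta> (x a) = x \<otimes>\<^bsub>BijGroup X\<^esub> ?\<delta> a \<otimes>\<^bsub>BijGroup X\<^esub> inv\<^bsub>BijGroup X\<^esub> x"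
        using left_translation_aut_conj[OF xA a] by (simp add: B.inv_mult_group B.m_assoc)
      then show ?thesis
        using B.m_inv_consistent[OF H xH] by (simp add: inner_group_def)
    qed
  qed
qed

lemma inv_inner_group_apply:
  assumes "a \<in> X" "b \<in> X"
  shows "(inv\<^bsub>inner_group\<^esub> (inv\<^bsub>BijGroup X\<^esub> left_translation a)) b = a \<triangleright> b"
proof -
  interpret B: group "BijGroup X" by (rule group_BijGroup)
  let ?\<delta> = "\<lambda>a. inv\<^bsub>BijGroup X\<^esub> left_translation a"
  have t: "left_translation a \<in> carrier (BijGroup X)" if "a \<in> X" for a
    using left_translation_aut[OF that] by (simp add: rack_auts_def)
  then have "subgroup (generate (BijGroup X) (?\<delta> ` X)) (BijGroup X)"
    by (intro B.generate_is_subgroup) auto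
  then have "inv\<^bsub>inner_group\<^esub> (?\<delta> a) = inv\<^bsub>BijGroup X\<^esub> (?\<delta> a)"
    unfolding inner_group_def using assms by (intro B.m_inv_consistent) (auto intro: generate.incl)
  then show ?thesis
    using t[OF assms(1)] assms by (simp add: left_translation_def)
qed

theorem iso_coset_rack:
  "\<exists>(G :: ('r \<Rightarrow> 'r) monoid) (I :: 'r set) C g (J :: 'r \<Rightarrow> 'r set) K f.
    coset_rack_data G I C g J K \<and>
    rack_iso X (\<triangleright>) (coset_rack G I J K) (coset_rack_op G g K) f"
proof -
  interpret E: equivariant_generators inner_group X "\<lambda>h. h"
      "\<lambda>a. inv\<^bsub>BijGroup X\<^esub> left_translation a"
    by (rule equivariant_generators_inner_group)
  have "rack_iso X (\<triangleright>) R rop' f"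
    if "rack_iso X (\<lambda>a. inv\<^bsub>inner_group\<^esub> (inv\<^bsub>BijGroup X\<^esub> left_translation a)) R rop' f"
    for R :: "('r \<times> 'r \<times> ('r \<Rightarrow> 'r) set) set" and rop' f
    using that by (simp add: rack_iso_def inv_inner_group_apply)
  then show ?thesis
    using E.coset_rack_data_representatives E.rack_iso_decomposition by blast
qed

end

theorem theorem5p3:
  shows
    "(\<forall>(G :: ('g, 'm) monoid_scheme) (I :: 'i set) C g (J :: 'i \<Rightarrow> 'j set) K.
        coset_rack_data G I C g J K \<longrightarrow>
          (\<forall>i\<in>I. \<forall>j\<in>J i. \<forall>a\<in>I. \<forall>b\<in>J a. \<forall>x\<in>carrier G. \<forall>y\<in>carrier G.
             coset_rack_op G g K (i, j, x <#\<^bsub>G\<^esub> K i j) (a, b, y <#\<^bsub>G\<^esub> K a b)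
             = (a, b, (x \<otimes>\<^bsub>G\<^esub> inv\<^bsub>G\<^esub> (g i) \<otimes>\<^bsub>G\<^esub> inv\<^bsub>G\<^esub> x \<otimes>\<^bsub>G\<^esub> y) <#\<^bsub>G\<^esub> K a b)) \<and>
          rack (coset_rack G I J K) (coset_rack_op G g K))
     \<and>
     (\<forall>(X :: 'r set) rop. rack X rop \<longrightarrow>
        (\<exists>(G :: ('r \<Rightarrow> 'r) monoid) (I :: 'r set) C g (J :: 'r \<Rightarrow> 'r set) K f.
           coset_rack_data G I C g J K \<and>
           rack_iso X rop (coset_rack G I J K) (coset_rack_op G g K) f))"
proof (intro conjI allI impI)
  show "\<forall>i\<in>I. \<forall>j\<in>J i. \<forall>a\<in>I. \<forall>b\<in>J a. \<forall>x\<in>carrier G. \<forall>y\<in>carrier G.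
      coset_rack_op G g K (i, j, x <#\<^bsub>G\<^esub> K i j) (a, b, y <#\<^bsub>G\<^esub> K a b)
      = (a, b, (x \<otimes>\<^bsub>G\<^esub> inv\<^bsub>G\<^esub> (g i) \<otimes>\<^bsub>G\<^esub> inv\<^bsub>G\<^esub> x \<otimes>\<^bsub>G\<^esub> y) <#\<^bsub>G\<^esub> K a b)"
    if "coset_rack_data G I C g J K"
    for G :: "('g, 'm) monoid_scheme" and I :: "'i set" and C g and J :: "'i \<Rightarrow> 'j set" and K
    using coset_rack_data.coset_rack_op_cosets[OF that] by (intro ballI)
  show "rack (coset_rack G I J K) (coset_rack_op G g K)"
    if "coset_rack_data G I C g J K"
    for G :: "('g, 'm) monoid_scheme" and I :: "'i set" and C g and J :: "'i \<Rightarrow> 'j set" and K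
    using that by (rule coset_rack_data.rack_coset_rack)
  show "\<exists>(G :: ('r \<Rightarrow> 'r) monoid) (I :: 'r set) C g (J :: 'r \<Rightarrow> 'r set) K f.
      coset_rack_data G I C g J K \<and>
      rack_iso X rop (coset_rack G I J K) (coset_rack_op G g K) f"
    if "rack X rop" for X :: "'r set" and rop
    using that by (rule rack.iso_coset_rack)
qed

end
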